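(* Let $A\in\mathbb{R}^{m\times d}$, $A\neq0$, and $b\in\mathbb{R}^m$. Let $(v^k)_{k\ge0}$ be generated by the random descent (RD) iteration (described in the context), with random directions $x$ satisfying the isotropy assumption with constant $c$, and with stepsizes $$\tau_k=-\frac{\langle Av^k-b,Ax\rangle}{\|Ax\|^2}\quad\text{if }Ax\neq0,\qquad \tau_k=0\quad\text{if }Ax=0 .$$ Then for every integer $N\ge1$ $$\min_{0\le k\le N-1}\mathbb{E}\big(\|A^T(Av^k-b)\|^2\big)\le\frac{c\|A\|^2\|b\|^2}{N}.$$ Moreover, the sequence $\left(\mathbb{E}(\|Av^k-b\|)\right)_k$ of expected residuals is decreasing (i.e. non-increasing). If furthermore $\lambda_{\min}(AA^T)>0$, then the sequence $\left(\mathbb{E}(\|Av^k-b\|^2)\right)_k$ converges at least linearly, i.e. for every $k\ge0$ $$\mathbb{E}\big(\|Av^k-b\|^2\big)\le\left(1-\frac{\lambda_{\min}(AA^T)}{c\|A\|^2}\right)^k\|Av^0-b\|^2 .$$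
   Context: $\|\cdot\|$ is the Euclidean norm for vectors and the corresponding operator (spectral) norm for matrices; $\lambda_{\min}$ is the smallest eigenvalue of a real symmetric matrix. Isotropy assumption on the random direction $x\in\mathbb{R}^d$: $\mathbb{E}(xx^T)=I_d$ and $\mathbb{E}(xx^T\|x\|^2)=c\,I_d$ for some constant $c$. Random descent (RD): $v^0=0\in\mathbb{R}^d$ and, for $k=0,1,2,\dots$, draw a random vector $x=x^k$ (independent of the previous draws, with fixed distribution) and set $v^{k+1}=v^k+\tau_kx$. $\mathbb{E}$ is the expectation over all involved randomness. *)

theory Defs
  imports "HOL-Analysis.Analysis" "HOL-Probability.Probability"
begin

definition spectral_norm :: "real^'n^'m \<Rightarrow> real" where
  "spectral_norm A = onorm (\<lambda>v. A *v v)"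

definition eigenvalues :: "real^'n^'n \<Rightarrow> real set" where
  "eigenvalues S = {l. \<exists>v. v \<noteq> 0 \<and> S *v v = l *\<^sub>R v}"

text \<open>Meaningful for symmetric matrices, whose set of real eigenvalues is finite and nonempty.\<close>

definition lambda_min :: "real^'n^'n \<Rightarrow> real" where
  "lambda_min S = Min (eigenvalues S)"

definition outer :: "real^'n \<Rightarrow> real^'n^'n" where
  "outer x = (\<chi> i j. x $ i * x $ j)"

text \<open>
  The isotropy assumption on a random direction with law \<open>D\<close>: E(x x^T) = I and
  E(x x^T |x|^2) = c I.  The expectations are matrix-valued Bochner integrals, whose existence is
  required explicitly because the integral of a non-integrable function is 0 by convention.
  The matrix c I is written \<open>mat c\<close>.
\<close>

definition isotropic :: "(real^'n) measure \<Rightarrow> real \<Rightarrow> bool" where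
  "isotropic D c \<longleftrightarrow>
     integrable D outer \<and> (\<integral>x. outer x \<partial>D) = mat 1 \<and>
     integrable D (\<lambda>x. (norm x)\<^sup>2 *\<^sub>R outer x) \<and>
     (\<integral>x. (norm x)\<^sup>2 *\<^sub>R outer x \<partial>D) = mat c"

text \<open>
  Random descent along a sequence \<open>x\<close> of directions, started at 0.  The stepsize rule \<open>\<tau>\<close> maps the
  current iterate and the current direction to the stepsize.
\<close>

primrec random_descent ::
    "(real^'n \<Rightarrow> real^'n \<Rightarrow> real) \<Rightarrow> (nat \<Rightarrow> real^'n) \<Rightarrow> nat \<Rightarrow> real^'n" where
  "random_descent \<tau> x 0 = 0"
| "random_descent \<tau> x (Suc k) =
     random_descent \<tau> x k + \<tau> (random_descent \<tau> x k) (x k) *\<^sub>R x k"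

definition line_search_step :: "real^'n^'m \<Rightarrow> real^'m \<Rightarrow> real^'n \<Rightarrow> real^'n \<Rightarrow> real" where
  "line_search_step A b v x =
     (if A *v x \<noteq> 0 then - ((A *v v - b) \<bullet> (A *v x)) / (norm (A *v x))\<^sup>2 else 0)"

end

theory Submission
  imports Defs
begin

text \<open>
  Write \<open>r\<close> for the residual \<open>A v - b\<close>, \<open>a = A\<^sup>T r\<close> for the gradient and \<open>L\<close> for the spectral norm.
  The stepsize is an exact line search, so one step projects the residual onto the complement of
  \<open>A x\<close> and lowers \<open>|r|\<^sup>2\<close> by exactly \<open>(r \<bullet> A x)\<^sup>2 / |A x|\<^sup>2 = (a \<bullet> x)\<^sup>2 / |A x|\<^sup>2\<close>
  (\<open>norm_sq_line_search_residual\<close>).  In particular residuals never grow, which already gives the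
  monotonicity of the expected residuals and bounds \<open>r\<close> and \<open>a\<close> by constants.

  The decrease is at least \<open>(a \<bullet> x)\<^sup>2 / (L\<^sup>2 |x|\<^sup>2)\<close>, but isotropy says nothing about \<open>1 / |x|\<^sup>2\<close>.
  Replacing the convex function \<open>s \<mapsto> 1/s\<close> by its tangent at \<open>s = c\<close>, namely
  \<open>1/s \<ge> 2/c - s/c\<^sup>2\<close>, leaves only the two moments that isotropy prescribes
  (\<open>line_search_decrease\<close>); they have the expectations \<open>|a|\<^sup>2\<close> and \<open>c |a|\<^sup>2\<close>, so the expected
  decrease is at least \<open>(2/c - c/c\<^sup>2) |a|\<^sup>2 / L\<^sup>2 = |a|\<^sup>2 / (c L\<^sup>2)\<close>.  To evaluate the moments with a
  random \<open>a\<close>, note that \<open>(a \<bullet> x)\<^sup>2\<close> is the matrix inner product of \<open>a a\<^sup>T\<close> with \<open>x x\<^sup>T\<close>, that the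
  current iterate is independent of the next direction (\<open>indep_var_random_descent\<close>), and that
  expectations of inner products of independent vectors factor (\<open>expectation_inner_indep\<close>).

  Hence \<open>E |r'|\<^sup>2 \<le> E |r|\<^sup>2 - E |a|\<^sup>2 / (c L\<^sup>2)\<close>.  Summing over \<open>N\<close> steps telescopes and bounds the
  smallest \<open>E |a|\<^sup>2\<close>.  Inserting \<open>|a|\<^sup>2 \<ge> \<lambda> |r|\<^sup>2\<close> with the least eigenvalue \<open>\<lambda>\<close> of \<open>A A\<^sup>T\<close>
  (\<open>lambda_min_gram_le\<close>) gives the linear rate; iterating it needs a nonnegative contraction factor,
  which holds since \<open>\<lambda> \<le> L\<^sup>2\<close> and \<open>c \<ge> 1\<close> (\<open>isotropic_constant_ge_1\<close>).
\<close>

section \<open>The spectral norm\<close>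

lemma inner_transpose_matrix_vector:
  fixes A :: "real^'n^'m"
  shows "(transpose A *v r) \<bullet> x = r \<bullet> (A *v x)"
  by (simp add: dot_lmul_matrix)

lemma norm_matrix_vector_le: "norm (A *v x) \<le> spectral_norm A * norm x"
  unfolding spectral_norm_def by (rule onorm) simp

lemma spectral_norm_nonneg: "spectral_norm A \<ge> 0"
  unfolding spectral_norm_def by (rule onorm_pos_le) simp

lemma spectral_norm_pos:
  assumes "A \<noteq> 0"
  shows "spectral_norm A > 0"
proof -
  have "\<not> (\<forall>x. A *v x = 0)"
    using assms by (metis matrix_eq matrix_vector_mult_0)
  then show ?thesis
    unfolding spectral_norm_def by (subst onorm_pos_lt) auto
qed

text \<open>
  With \<open>a = A\<^sup>T r\<close>, Cauchy-Schwarz gives \<open>|a|\<^sup>2 = r \<bullet> A a \<le> |r| L |a|\<close>; cancel \<open>|a|\<close>.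
\<close>

lemma norm_transpose_matrix_vector_le:
  "norm (transpose A *v r) \<le> spectral_norm A * norm r"
proof -
  define a where "a = transpose A *v r"
  have "norm a * norm a = r \<bullet> (A *v a)"
    by (metis a_def inner_transpose_matrix_vector power2_eq_square power2_norm_eq_inner)
  also have "\<dots> \<le> norm r * norm (A *v a)"
    by (rule norm_cauchy_schwarz)
  also have "\<dots> \<le> norm r * (spectral_norm A * norm a)"
    by (intro mult_left_mono norm_matrix_vector_le) simp
  finally have "norm a * norm a \<le> (spectral_norm A * norm r) * norm a"
    by (simp add: mult_ac)
  then have "norm a \<le> spectral_norm A * norm r"
    using spectral_norm_nonneg[of A] by (cases "a = 0") auto
  then show ?thesis by (simp only: a_def)
qed

section \<open>The least eigenvalue of a symmetric matrix\<close>

lemma symmetric_inner_commute: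
  fixes S :: "real^'n^'n"
  assumes "transpose S = S"
  shows "(S *v u) \<bullet> w = u \<bullet> (S *v w)"
  by (metis assms inner_transpose_matrix_vector)

text \<open>
  Eigenvectors for different eigenvalues of a symmetric matrix are orthogonal, and an orthogonal
  set in finite dimension is finite.  Finiteness is what makes the \<open>Min\<close> in \<open>lambda_min\<close> an actual
  lower bound of the eigenvalues.
\<close>

lemma finite_eigenvalues_symmetric:
  fixes S :: "real^'n^'n"
  assumes sym: "transpose S = S"
  shows "finite (eigenvalues S)"
proof -
  have "\<forall>l\<in>eigenvalues S. \<exists>u. u \<noteq> 0 \<and> S *v u = l *\<^sub>R u"
    by (auto simp: eigenvalues_def)
  then obtain f where f: "\<And>l. l \<in> eigenvalues S \<Longrightarrow> f l \<noteq> 0 \<and> S *v f l = l *\<^sub>R f l"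
    by metis
  have inj: "inj_on f (eigenvalues S)"
    by (rule inj_onI) (metis f scaleR_cancel_right)
  have orth: "f l \<bullet> f l' = 0" if "l \<in> eigenvalues S" "l' \<in> eigenvalues S" "l \<noteq> l'" for l l'
  proof -
    have "l * (f l \<bullet> f l') = l' * (f l \<bullet> f l')"
      using symmetric_inner_commute[OF sym, of "f l" "f l'"] f[OF that(1)] f[OF that(2)] by simp
    then show ?thesis using that(3) by simp
  qed
  have "pairwise orthogonal (f ` eigenvalues S)"
    unfolding pairwise_def orthogonal_def using orth by blast
  then show ?thesis
    using inj pairwise_orthogonal_imp_finite finite_imageD by blast
qed

text \<open>
  The form \<open>w \<bullet> S w - \<mu> |w|\<^sup>2\<close> is nonnegative and vanishes at \<open>u\<close>, so its first variation at \<open>u\<close>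
  vanishes.  In the direction of the gradient \<open>g = S u - \<mu> u\<close> that variation is \<open>2 |g|\<^sup>2\<close>, so \<open>g = 0\<close>.
\<close>

lemma min_quadratic_form_eigenvector:
  fixes S :: "real^'n^'n"
  assumes sym: "transpose S = S"
    and min: "\<And>w. \<mu> * (norm w)\<^sup>2 \<le> w \<bullet> (S *v w)"
    and u: "u \<bullet> (S *v u) = \<mu> * (norm u)\<^sup>2"
  shows "S *v u = \<mu> *\<^sub>R u"
proof -
  define g where "g = S *v u - \<mu> *\<^sub>R u"
  define B where "B = g \<bullet> (S *v g) - \<mu> * (norm g)\<^sup>2"
  have B: "B \<ge> 0" using min[of g] by (simp add: B_def)
  have quad: "0 \<le> 2 * t * (norm g)\<^sup>2 + t\<^sup>2 * B" for t
  proof -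
    have ug: "u \<bullet> (S *v g) = g \<bullet> (S *v u)"
      by (metis inner_commute symmetric_inner_commute[OF sym])
    have gg: "(norm g)\<^sup>2 = g \<bullet> (S *v u) - \<mu> * (g \<bullet> u)"
      unfolding power2_norm_eq_inner
      by (subst (2) g_def) (simp add: inner_diff_right)
    have 1: "(u + t *\<^sub>R g) \<bullet> (S *v (u + t *\<^sub>R g))
        = u \<bullet> (S *v u) + 2 * t * (g \<bullet> (S *v u)) + t\<^sup>2 * (g \<bullet> (S *v g))"
      by (simp add: matrix_vector_right_distrib matrix_vector_mult_scaleR inner_add_left
          inner_add_right ug algebra_simps power2_eq_square)
    have 2: "(norm (u + t *\<^sub>R g))\<^sup>2 = (norm u)\<^sup>2 + 2 * t * (g \<bullet> u) + t\<^sup>2 * (norm g)\<^sup>2"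
      unfolding power2_norm_eq_inner unfolding power2_eq_square
      by (simp add: inner_commute algebra_simps)
    show ?thesis
      using min[of "u + t *\<^sub>R g"] unfolding 1 2 u gg B_def by (simp add: algebra_simps)
  qed
  (* A small negative t makes the linear term win; t = - |g|^2 / (B + 1) is small enough for every
     B \<ge> 0 and turns the inequality into a polynomial identity in q. *)
  define q where "q = (norm g)\<^sup>2 / (B + 1)"
  have gq: "(norm g)\<^sup>2 = q * (B + 1)" using B by (simp add: q_def)
  have "0 \<le> 2 * (- q) * (q * (B + 1)) + (- q)\<^sup>2 * B"
    using quad[of "- q"] unfolding gq .
  also have "\<dots> = - (q\<^sup>2 * (B + 2))" by (simp add: algebra_simps power2_eq_square)
  finally have "q\<^sup>2 * (B + 2) \<le> 0" by simp
  then have "q = 0" using B by (auto simp: mult_le_0_iff)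
  with gq have "g = 0" by simp
  then show ?thesis by (simp add: g_def)
qed

text \<open>
  The Rayleigh quotient attains its minimum on the compact unit sphere.  The minimum \<open>\<mu>\<close> is an
  eigenvalue, so it is no smaller than the least one.
\<close>

lemma lambda_min_le_quadratic_form:
  fixes S :: "real^'n^'n"
  assumes sym: "transpose S = S"
  shows "lambda_min S * (norm w)\<^sup>2 \<le> w \<bullet> (S *v w)"
proof -
  have cont: "continuous_on (sphere 0 1) (\<lambda>w. w \<bullet> (S *v w))"
    by (intro continuous_intros linear_continuous_on) auto
  have "axis undefined 1 \<in> sphere (0::real^'n) 1" by simp
  then have "sphere (0::real^'n) 1 \<noteq> {}" by blast
  then obtain u where u: "u \<in> sphere 0 1"
    and min: "\<forall>w\<in>sphere 0 1. u \<bullet> (S *v u) \<le> w \<bullet> (S *v w)"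
    using continuous_attains_inf[OF compact_sphere _ cont] by blast
  define \<mu> where "\<mu> = u \<bullet> (S *v u)"
  have min': "\<mu> * (norm w)\<^sup>2 \<le> w \<bullet> (S *v w)" for w
  proof (cases "w = 0")
    case False
    have "\<mu> \<le> (w /\<^sub>R norm w) \<bullet> (S *v (w /\<^sub>R norm w))"
      unfolding \<mu>_def using False by (intro min[rule_format]) simp
    also have "\<dots> = (w \<bullet> (S *v w)) / (norm w)\<^sup>2"
      by (simp add: matrix_vector_mult_scaleR power2_eq_square field_simps)
    finally show ?thesis using False by (simp add: field_simps)
  qed simp
  have "S *v u = \<mu> *\<^sub>R u"
    using sym min' by (rule min_quadratic_form_eigenvector) (use u in \<open>simp add: \<mu>_def\<close>)
  then have "\<mu> \<in> eigenvalues S"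
    using u by (auto simp: eigenvalues_def intro!: exI[of _ u])
  then have "lambda_min S \<le> \<mu>"
    unfolding lambda_min_def using finite_eigenvalues_symmetric[OF sym] by (rule Min_le[rotated])
  then have "lambda_min S * (norm w)\<^sup>2 \<le> \<mu> * (norm w)\<^sup>2"
    by (rule mult_right_mono) simp
  with min'[of w] show ?thesis by linarith
qed

lemma lambda_min_gram_le:
  "lambda_min (A ** transpose A) * (norm r)\<^sup>2 \<le> (norm (transpose A *v r))\<^sup>2"
proof -
  have "transpose (A ** transpose A) = A ** transpose A"
    unfolding matrix_transpose_mul transpose_transpose ..
  then have "lambda_min (A ** transpose A) * (norm r)\<^sup>2 \<le> r \<bullet> ((A ** transpose A) *v r)"
    by (rule lambda_min_le_quadratic_form)
  also have "\<dots> = (norm (transpose A *v r))\<^sup>2"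
    by (metis inner_transpose_matrix_vector matrix_vector_mul_assoc power2_norm_eq_inner)
  finally show ?thesis .
qed

text \<open>
  Keeps the contraction factor nonnegative.  It follows by testing the Rayleigh bound on any unit
  vector.
\<close>

lemma lambda_min_gram_le_spectral_norm:
  fixes A :: "real^'n^'m"
  shows "lambda_min (A ** transpose A) \<le> (spectral_norm A)\<^sup>2"
proof -
  define e where "e = (axis undefined 1 :: real^'m)"
  have e: "norm e = 1" by (simp add: e_def)
  have "norm (transpose A *v e) \<le> spectral_norm A"
    using norm_transpose_matrix_vector_le[of A e] unfolding e mult_1_right .
  then have "(norm (transpose A *v e))\<^sup>2 \<le> (spectral_norm A)\<^sup>2"
    by (rule power_mono) (rule norm_ge_zero)
  moreover have "lambda_min (A ** transpose A) \<le> (norm (transpose A *v e))\<^sup>2"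
    using lambda_min_gram_le[of A e] unfolding e power_one mult_1_right .
  ultimately show ?thesis by (rule order_trans[rotated])
qed

section \<open>Isotropic directions\<close>

text \<open>
  Matrices carry the entrywise inner product.  Through it the quadratic form \<open>x \<mapsto> (a \<bullet> x)\<^sup>2\<close> becomes
  linear in \<open>x x\<^sup>T\<close>, so the matrix moments of an isotropic law can be substituted directly.
\<close>

lemma inner_outer_outer: "outer a \<bullet> outer x = (a \<bullet> x)\<^sup>2"
proof -
  have "outer a \<bullet> outer x = (\<Sum>i\<in>UNIV. \<Sum>j\<in>UNIV. (a $ i * x $ i) * (a $ j * x $ j))"
    by (simp add: outer_def inner_vec_def algebra_simps)
  also have "\<dots> = (a \<bullet> x)\<^sup>2"
    unfolding power2_eq_square inner_vec_def sum_product by simp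
  finally show ?thesis .
qed

lemma inner_outer_mat: "outer a \<bullet> mat c = c * (norm a)\<^sup>2"
proof -
  have "outer a \<bullet> mat c = (\<Sum>i\<in>UNIV. \<Sum>j\<in>UNIV. if i = j then c * (a $ i * a $ i) else 0)"
    unfolding inner_vec_def by (intro sum.cong refl) (simp add: outer_def mat_def)
  also have "\<dots> = c * (norm a)\<^sup>2"
    by (simp add: power2_norm_eq_inner inner_vec_def sum_distrib_left)
  finally show ?thesis .
qed

lemma norm_outer: "norm (outer a) = (norm a)\<^sup>2"
proof -
  have "(norm (outer a))\<^sup>2 = ((norm a)\<^sup>2)\<^sup>2"
    unfolding power2_norm_eq_inner by (rule inner_outer_outer)
  then show ?thesis by (simp only: power2_eq_iff_nonneg norm_ge_zero zero_le_power2)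
qed

text \<open>
  For a unit vector \<open>e\<close> put \<open>s = e \<bullet> x\<close>.  Then \<open>|x|\<^sup>2 s\<^sup>2 \<ge> s\<^sup>4 \<ge> 2 s\<^sup>2 - 1\<close>, and taking expectations on
  both ends yields \<open>c \<ge> 2 - 1\<close>.
\<close>

lemma isotropic_constant_ge_1:
  fixes D :: "(real^'n) measure"
  assumes "prob_space D" and iso: "isotropic D c"
  shows "c \<ge> 1"
proof -
  interpret prob_space D by fact
  define B where "B = (outer (axis undefined 1) :: real^'n^'n)"
  have e: "norm (axis undefined 1 :: real^'n) = 1" by simp
  have int: "integrable D (\<lambda>x. B \<bullet> f x)" "(\<integral>x. B \<bullet> f x \<partial>D) = s"
    if "integrable D f" "(\<integral>x. f x \<partial>D) = mat s" for f s
  proof -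
    show "integrable D (\<lambda>x. B \<bullet> f x)" using that(1) by (rule integrable_inner_right)
    have "(\<integral>x. B \<bullet> f x \<partial>D) = B \<bullet> (\<integral>x. f x \<partial>D)"
      using that(1) by (rule integral_inner_right)
    then show "(\<integral>x. B \<bullet> f x \<partial>D) = s" by (simp add: that(2) B_def inner_outer_mat)
  qed
  have iso: "integrable D outer" "(\<integral>x. outer x \<partial>D) = mat 1"
      "integrable D (\<lambda>x. (norm x)\<^sup>2 *\<^sub>R outer x)" "(\<integral>x. (norm x)\<^sup>2 *\<^sub>R outer x \<partial>D) = mat c"
    using iso by (auto simp: isotropic_def)
  note i1 = int(1)[OF iso(1,2)] and v1 = int(2)[OF iso(1,2)]
    and i2 = int(1)[OF iso(3,4)] and v2 = int(2)[OF iso(3,4)]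
  have le: "2 * (B \<bullet> outer x) - 1 \<le> B \<bullet> ((norm x)\<^sup>2 *\<^sub>R outer x)" for x :: "real^'n"
  proof -
    define s where "s = (axis undefined 1 :: real^'n) \<bullet> x"
    have B: "B \<bullet> outer x = s\<^sup>2" by (simp add: B_def inner_outer_outer s_def)
    have "\<bar>s\<bar> \<le> norm x" using Cauchy_Schwarz_ineq2[of "axis undefined 1" x] by (simp add: s_def)
    then have "s\<^sup>2 \<le> (norm x)\<^sup>2" by (metis abs_ge_zero power2_abs power_mono)
    then have "s\<^sup>2 * s\<^sup>2 \<le> (norm x)\<^sup>2 * s\<^sup>2" by (rule mult_right_mono) simp
    moreover have "0 \<le> (s\<^sup>2 - 1)\<^sup>2" by simp
    ultimately show ?thesis by (simp add: B power2_diff)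
  qed
  have "integrable D (\<lambda>x. 2 * (B \<bullet> outer x) - 1)"
    using i1 by simp
  then have "(\<integral>x. 2 * (B \<bullet> outer x) - 1 \<partial>D) \<le> (\<integral>x. B \<bullet> ((norm x)\<^sup>2 *\<^sub>R outer x) \<partial>D)"
    using i2 le by (rule integral_mono)
  moreover have "(\<integral>x. 2 * (B \<bullet> outer x) - 1 \<partial>D) = 2 * (\<integral>x. B \<bullet> outer x \<partial>D) - 1"
    using i1 by (simp add: prob_space)
  ultimately show ?thesis unfolding v1 v2 by simp
qed

section \<open>Inner products of independent vectors\<close>

text \<open>
  Expand the inner product in an orthonormal basis and apply the product rule for independent
  real random variables to each coordinate.
\<close>

lemma (in prob_space) expectation_inner_indep:
  fixes V Y :: "'a \<Rightarrow> 'b::euclidean_space"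
  assumes ind: "indep_var borel V borel Y" and V: "integrable M V" and Y: "integrable M Y"
  shows "integrable M (\<lambda>\<omega>. V \<omega> \<bullet> Y \<omega>)"
    and "expectation (\<lambda>\<omega>. V \<omega> \<bullet> Y \<omega>) = expectation V \<bullet> expectation Y"
proof -
  have indB: "indep_var borel (\<lambda>\<omega>. V \<omega> \<bullet> B) borel (\<lambda>\<omega>. Y \<omega> \<bullet> B)" for B
    using indep_var_compose[OF ind, of "\<lambda>y. y \<bullet> B" borel "\<lambda>y. y \<bullet> B" borel] by (simp add: comp_def)
  have iV: "integrable M (\<lambda>\<omega>. V \<omega> \<bullet> B)" and iY: "integrable M (\<lambda>\<omega>. Y \<omega> \<bullet> B)" for B
    using V Y by auto
  have i: "integrable M (\<lambda>\<omega>. (V \<omega> \<bullet> B) * (Y \<omega> \<bullet> B))" for B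
    using indB iV iY by (rule indep_var_integrable)
  have eq: "V \<omega> \<bullet> Y \<omega> = (\<Sum>B\<in>Basis. (V \<omega> \<bullet> B) * (Y \<omega> \<bullet> B))" for \<omega>
    by (rule euclidean_inner)
  show "integrable M (\<lambda>\<omega>. V \<omega> \<bullet> Y \<omega>)"
    unfolding eq by (intro Bochner_Integration.integrable_sum i)
  have "expectation (\<lambda>\<omega>. V \<omega> \<bullet> Y \<omega>) = (\<Sum>B\<in>Basis. expectation (\<lambda>\<omega>. (V \<omega> \<bullet> B) * (Y \<omega> \<bullet> B)))"
    unfolding eq by (intro Bochner_Integration.integral_sum i)
  also have "\<dots> = (\<Sum>B\<in>Basis. (expectation V \<bullet> B) * (expectation Y \<bullet> B))"
    using indep_var_lebesgue_integral[OF indB iV iY] V Y by (simp add: integral_inner_left)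
  also have "\<dots> = expectation V \<bullet> expectation Y"
    by (rule euclidean_inner[symmetric])
  finally show "expectation (\<lambda>\<omega>. V \<omega> \<bullet> Y \<omega>) = expectation V \<bullet> expectation Y" .
qed

section \<open>One step of exact line search\<close>

text \<open>
  The case distinction of the stepsize disappears here: for \<open>A y = 0\<close> the correction is a multiple
  of the zero vector.
\<close>

lemma line_search_residual:
  "A *v (w + line_search_step A b w y *\<^sub>R y) - b
    = (A *v w - b) - (((A *v w - b) \<bullet> (A *v y)) / (norm (A *v y))\<^sup>2) *\<^sub>R (A *v y)"
  by (simp add: line_search_step_def matrix_vector_right_distrib matrix_vector_mult_scaleR)

text \<open>
  Pythagoras for the projection of the residual along \<open>A y\<close>.  For \<open>A y = 0\<close> the quotient is \<open>0 / 0 = 0\<close>,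
  the correct decrease.
\<close>

lemma norm_sq_line_search_residual:
  "(norm (A *v (w + line_search_step A b w y *\<^sub>R y) - b))\<^sup>2
    = (norm (A *v w - b))\<^sup>2 - ((A *v w - b) \<bullet> (A *v y))\<^sup>2 / (norm (A *v y))\<^sup>2"
proof -
  define r z where "r = A *v w - b" and "z = A *v y"
  define s where "s = (r \<bullet> z) / (norm z)\<^sup>2"
  have "(norm (r - s *\<^sub>R z))\<^sup>2 = (norm r)\<^sup>2 - 2 * s * (r \<bullet> z) + s\<^sup>2 * (norm z)\<^sup>2"
    unfolding power2_norm_eq_inner unfolding power2_eq_square
    by (simp add: inner_commute algebra_simps)
  also have "\<dots> = (norm r)\<^sup>2 - (r \<bullet> z)\<^sup>2 / (norm z)\<^sup>2"
    by (cases "z = 0") (auto simp: s_def field_simps power2_eq_square)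
  finally show ?thesis unfolding line_search_residual s_def r_def z_def .
qed

lemma norm_line_search_residual_le:
  "norm (A *v (w + line_search_step A b w y *\<^sub>R y) - b) \<le> norm (A *v w - b)"
proof (rule power2_le_imp_le)
  show "(norm (A *v (w + line_search_step A b w y *\<^sub>R y) - b))\<^sup>2 \<le> (norm (A *v w - b))\<^sup>2"
    unfolding norm_sq_line_search_residual by simp
qed simp

text \<open>
  The exact decrease is bounded below by an expression linear in \<open>y y\<^sup>T\<close> and \<open>|y|\<^sup>2 y y\<^sup>T\<close>, the two
  matrices whose means isotropy fixes.  The coefficients come from the tangent of \<open>s \<mapsto> 1/s\<close> at \<open>s = c\<close>;
  this is the point of tangency that maximizes the resulting expected decrease.
\<close>

lemma line_search_decrease:
  fixes A :: "real^'n^'m"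
  assumes "A \<noteq> 0" and "c > 0" and a: "a = transpose A *v (A *v w - b)"
  shows "(norm (A *v (w + line_search_step A b w y *\<^sub>R y) - b))\<^sup>2
    \<le> (norm (A *v w - b))\<^sup>2
      - (2 / c * (outer a \<bullet> outer y) - outer a \<bullet> ((norm y)\<^sup>2 *\<^sub>R outer y) / c\<^sup>2) / (spectral_norm A)\<^sup>2"
proof -
  define L p z where "L = spectral_norm A" and "p = a \<bullet> y" and "z = A *v y"
  have L: "L > 0" unfolding L_def using assms(1) by (rule spectral_norm_pos)
  have p: "p = (A *v w - b) \<bullet> z"
    unfolding p_def a z_def by (rule inner_transpose_matrix_vector)
  have "(2 / c - (norm y)\<^sup>2 / c\<^sup>2) * p\<^sup>2 / L\<^sup>2 \<le> p\<^sup>2 / (norm z)\<^sup>2"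
  proof (cases "z = 0")
    case True
    then show ?thesis by (simp add: p)
  next
    case False
    then have y: "norm y > 0" by (auto simp: z_def)
    (* The gap between 1/s and its tangent at c, for s = |y|^2, is this square. *)
    have "0 \<le> (1 / norm y - norm y / c)\<^sup>2" by simp
    also have "\<dots> = 1 / (norm y)\<^sup>2 - (2 / c - (norm y)\<^sup>2 / c\<^sup>2)"
      using y \<open>c > 0\<close> by (simp add: power2_diff power_divide)
    finally have "2 / c - (norm y)\<^sup>2 / c\<^sup>2 \<le> 1 / (norm y)\<^sup>2" by simp
    then have "(2 / c - (norm y)\<^sup>2 / c\<^sup>2) * (p\<^sup>2 / L\<^sup>2) \<le> 1 / (norm y)\<^sup>2 * (p\<^sup>2 / L\<^sup>2)"
      by (rule mult_right_mono) simp
    also have "\<dots> = p\<^sup>2 / (L * norm y)\<^sup>2" by (simp add: power_mult_distrib)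
    also have "\<dots> \<le> p\<^sup>2 / (norm z)\<^sup>2"
      using False norm_matrix_vector_le[of A y]
      by (intro divide_left_mono power_mono) (auto simp: L_def z_def intro!: mult_pos_pos)
    finally show ?thesis by simp
  qed
  moreover have "(2 / c - (norm y)\<^sup>2 / c\<^sup>2) * p\<^sup>2 =
      2 / c * (outer a \<bullet> outer y) - outer a \<bullet> ((norm y)\<^sup>2 *\<^sub>R outer y) / c\<^sup>2"
    by (simp add: inner_outer_outer p_def left_diff_distrib)
  ultimately show ?thesis
    unfolding norm_sq_line_search_residual by (simp add: L_def p z_def)
qed

section \<open>The iterates as random variables\<close>

text \<open>
  Since residuals never grow, they are bounded uniformly over all direction sequences; this makes
  all random variables built from the iterates integrable.
\<close>

lemma norm_random_descent_residual_le:
  "norm (A *v random_descent (line_search_step A b) y k - b) \<le> norm b"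
proof (induction k)
  case (Suc k)
  then show ?case
    unfolding random_descent.simps by (rule order_trans[OF norm_line_search_residual_le])
qed simp

lemma random_descent_cong:
  "(\<And>j. j < k \<Longrightarrow> y j = y' j) \<Longrightarrow> random_descent \<tau> y k = random_descent \<tau> y' k"
  by (induction k) auto

lemma measurable_matrix_vector [measurable]:
  fixes A :: "real^'n^'m"
  shows "(*v) A \<in> borel_measurable borel"
  by (intro borel_measurable_continuous_onI linear_continuous_on) simp

lemma measurable_line_search_step:
  assumes [measurable]: "f \<in> borel_measurable N" "g \<in> borel_measurable N"
  shows "(\<lambda>\<omega>. line_search_step A b (f \<omega>) (g \<omega>)) \<in> borel_measurable N"
  unfolding line_search_step_def by measurable

text \<open>
  The number \<open>n\<close> of coordinates is kept apart from the step \<open>k\<close> so that the induction on \<open>k\<close> stays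
  within one product space.
\<close>

lemma measurable_random_descent:
  assumes "k \<le> n"
  shows "(\<lambda>y. random_descent (line_search_step A b) y k)
    \<in> borel_measurable (PiM {..<n} (\<lambda>_. borel))"
  using assms
proof (induction k)
  case (Suc k)
  then have [measurable]: "(\<lambda>y. random_descent (line_search_step A b) y k)
      \<in> borel_measurable (PiM {..<n} (\<lambda>_. borel))"
    "(\<lambda>y. y k) \<in> borel_measurable (PiM {..<n} (\<lambda>_. borel))"
    by (auto intro: measurable_component_singleton)
  note measurable_line_search_step[measurable]
  show ?case by simp
qed simp

text \<open>
  The iterate \<open>k\<close> is a measurable function of the directions \<open>0, \<dots>, k - 1\<close> alone, a block of indices
  disjoint from \<open>k\<close>.
\<close>

lemma (in prob_space) indep_var_random_descent:
  assumes "indep_vars (\<lambda>_. borel) x UNIV"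
  shows "indep_var borel (\<lambda>\<omega>. random_descent (line_search_step A b) (\<lambda>j. x j \<omega>) k) borel (x k)"
proof -
  let ?F = "\<lambda>y. random_descent (line_search_step A b) y k"
  have "indep_var (PiM {..<k} (\<lambda>_. borel)) (\<lambda>\<omega>. restrict (\<lambda>i. x i \<omega>) {..<k})
      (PiM {k} (\<lambda>_. borel)) (\<lambda>\<omega>. restrict (\<lambda>i. x i \<omega>) {k})"
    using assms by (rule indep_var_restrict) auto
  then have "indep_var borel (?F \<circ> (\<lambda>\<omega>. restrict (\<lambda>i. x i \<omega>) {..<k}))
      borel ((\<lambda>y. y k) \<circ> (\<lambda>\<omega>. restrict (\<lambda>i. x i \<omega>) {k}))"
    by (rule indep_var_compose) (auto intro: measurable_random_descent measurable_component_singleton)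
  moreover have "?F \<circ> (\<lambda>\<omega>. restrict (\<lambda>i. x i \<omega>) {..<k}) = (\<lambda>\<omega>. ?F (\<lambda>j. x j \<omega>))"
    by (auto simp: fun_eq_iff intro!: random_descent_cong)
  moreover have "(\<lambda>y. y k) \<circ> (\<lambda>\<omega>. restrict (\<lambda>i. x i \<omega>) {k}) = x k"
    by (auto simp: fun_eq_iff)
  ultimately show ?thesis by simp
qed

section \<open>Convergence of random descent\<close>

theorem theorem3p12:
  fixes A :: "real^'d^'m" and b :: "real^'m"
    and M :: "'w measure" and x :: "nat \<Rightarrow> 'w \<Rightarrow> real^'d"
    and D :: "(real^'d) measure" and c :: real
    and v :: "nat \<Rightarrow> 'w \<Rightarrow> real^'d"
  assumes "A \<noteq> 0"
    and "prob_space M"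
    and "prob_space.indep_vars M (\<lambda>_. borel) x UNIV"
    and "\<And>k. distr M borel (x k) = D"
    and "isotropic D c"
    and v_def: "\<And>k \<omega>. v k \<omega> = random_descent (line_search_step A b) (\<lambda>j. x j \<omega>) k"
  shows "(\<forall>N\<ge>1. Min ((\<lambda>k. \<integral>\<omega>. (norm (transpose A *v (A *v v k \<omega> - b)))\<^sup>2 \<partial>M) ` {0..N - 1})
            \<le> c * (spectral_norm A)\<^sup>2 * (norm b)\<^sup>2 / real N) \<and>
         decseq (\<lambda>k. \<integral>\<omega>. norm (A *v v k \<omega> - b) \<partial>M) \<and>
         (lambda_min (A ** transpose A) > 0 \<longrightarrow>
            (\<forall>k. (\<integral>\<omega>. (norm (A *v v k \<omega> - b))\<^sup>2 \<partial>M)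
              \<le> (1 - lambda_min (A ** transpose A) / (c * (spectral_norm A)\<^sup>2)) ^ k
                 * (norm (A *v 0 - b))\<^sup>2))"
proof -
  interpret prob_space M by fact
  define L where "L = spectral_norm A"
  define a where "a k \<omega> = transpose A *v (A *v v k \<omega> - b)" for k \<omega>
  define R where "R k = (\<integral>\<omega>. (norm (A *v v k \<omega> - b))\<^sup>2 \<partial>M)" for k
  define G where "G k = (\<integral>\<omega>. (norm (a k \<omega>))\<^sup>2 \<partial>M)" for k
  have L: "L > 0" unfolding L_def using \<open>A \<noteq> 0\<close> by (rule spectral_norm_pos)
  have x_meas [measurable]: "x k \<in> borel_measurable M" for k
    using assms(3) by (simp add: indep_vars_def)
  have "prob_space D"
    using prob_space_distr[OF x_meas[of 0]] assms(4) by simp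
  then have c: "c \<ge> 1" using \<open>isotropic D c\<close> by (rule isotropic_constant_ge_1)
  have ind: "indep_var borel (v k) borel (x k)" for k
    using indep_var_random_descent[OF assms(3), of A b k] by (simp add: v_def[abs_def])
  have v_meas [measurable]: "v k \<in> borel_measurable M" for k
    using ind by (rule indep_var_rv1)
  have v_Suc: "v (Suc k) \<omega> = v k \<omega> + line_search_step A b (v k \<omega>) (x k \<omega>) *\<^sub>R x k \<omega>" for k \<omega>
    by (simp add: v_def)
  have v_bd: "norm (A *v v k \<omega> - b) \<le> norm b" for k \<omega>
    unfolding v_def by (rule norm_random_descent_residual_le)
  have a_bd: "(norm (a k \<omega>))\<^sup>2 \<le> (L * norm b)\<^sup>2" for k \<omega>
  proof (rule power_mono)
    have "norm (a k \<omega>) \<le> L * norm (A *v v k \<omega> - b)"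
      unfolding a_def L_def by (rule norm_transpose_matrix_vector_le)
    also have "\<dots> \<le> L * norm b"
      using v_bd L by (simp add: mult_left_mono)
    finally show "norm (a k \<omega>) \<le> L * norm b" .
  qed simp
  have a_meas [measurable]: "a k \<in> borel_measurable M" for k
    unfolding a_def[abs_def] by measurable
  have outer_meas [measurable]: "outer \<in> borel_measurable borel"
    unfolding outer_def[abs_def]
    by (intro borel_measurable_continuous_onI continuous_intros)
  have int_a: "integrable M (\<lambda>\<omega>. (norm (a k \<omega>))\<^sup>2)" for k
    by (rule integrable_const_bound[where B="(L * norm b)\<^sup>2"]) (use a_bd in auto)
  have int_oa: "integrable M (\<lambda>\<omega>. outer (a k \<omega>))" for k
    by (rule integrable_const_bound[where B="(L * norm b)\<^sup>2"]) (use a_bd in \<open>auto simp: norm_outer\<close>)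
  have int_r: "integrable M (\<lambda>\<omega>. norm (A *v v k \<omega> - b))" for k
    by (rule integrable_const_bound[where B="norm b"]) (use v_bd in auto)
  have int_r2: "integrable M (\<lambda>\<omega>. (norm (A *v v k \<omega> - b))\<^sup>2)" for k
    by (rule integrable_const_bound[where B="(norm b)\<^sup>2"]) (use v_bd in \<open>auto intro!: power_mono\<close>)
  (* Both isotropy conditions enter in this form: f is y y^T with s = 1, or |y|^2 y y^T with s = c. *)
  have moment: "integrable M (\<lambda>\<omega>. outer (a k \<omega>) \<bullet> f (x k \<omega>))"
      "(\<integral>\<omega>. outer (a k \<omega>) \<bullet> f (x k \<omega>) \<partial>M) = s * G k"
    if f [measurable]: "f \<in> borel_measurable borel" and fi: "integrable D f"
      and fv: "(\<integral>y. f y \<partial>D) = mat s" for k f s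
  proof -
    have i: "indep_var borel (\<lambda>\<omega>. outer (a k \<omega>)) borel (\<lambda>\<omega>. f (x k \<omega>))"
    proof -
      have "(\<lambda>w. outer (transpose A *v (A *v w - b))) \<in> borel_measurable borel"
        by measurable
      from indep_var_compose[OF ind this f] show ?thesis
        unfolding comp_def a_def .
    qed
    have fx: "integrable M (\<lambda>\<omega>. f (x k \<omega>))"
      using fi by (subst integrable_distr_eq[symmetric, where N=borel]) (auto simp: assms(4))
    have E: "(\<integral>\<omega>. f (x k \<omega>) \<partial>M) = mat s"
      by (subst integral_distr[symmetric, where N=borel]) (auto simp: assms(4) fv)
    show "integrable M (\<lambda>\<omega>. outer (a k \<omega>) \<bullet> f (x k \<omega>))"
      by (rule expectation_inner_indep[OF i int_oa fx])
    have "(\<integral>\<omega>. outer (a k \<omega>) \<bullet> f (x k \<omega>) \<partial>M) = (\<integral>\<omega>. outer (a k \<omega>) \<partial>M) \<bullet> mat s"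
      using expectation_inner_indep(2)[OF i int_oa fx] by (simp add: E)
    also have "\<dots> = (\<integral>\<omega>. outer (a k \<omega>) \<bullet> mat s \<partial>M)"
      by (rule integral_inner_left[symmetric]) (rule int_oa)
    finally show "(\<integral>\<omega>. outer (a k \<omega>) \<bullet> f (x k \<omega>) \<partial>M) = s * G k"
      by (simp add: inner_outer_mat G_def)
  qed
  have descent: "R (Suc k) \<le> R k - G k / (c * L\<^sup>2)" for k
  proof -
    have iso: "integrable D outer" "(\<integral>y. outer y \<partial>D) = mat 1"
      "integrable D (\<lambda>y. (norm y)\<^sup>2 *\<^sub>R outer y)" "(\<integral>y. (norm y)\<^sup>2 *\<^sub>R outer y \<partial>D) = mat c"
      using \<open>isotropic D c\<close> by (auto simp: isotropic_def)
    let ?p = "\<lambda>\<omega>. outer (a k \<omega>) \<bullet> outer (x k \<omega>)"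
    let ?q = "\<lambda>\<omega>. outer (a k \<omega>) \<bullet> ((norm (x k \<omega>))\<^sup>2 *\<^sub>R outer (x k \<omega>))"
    have p: "integrable M ?p" "(\<integral>\<omega>. ?p \<omega> \<partial>M) = G k"
      using moment[OF _ iso(1,2)] by auto
    have q: "integrable M ?q" "(\<integral>\<omega>. ?q \<omega> \<partial>M) = c * G k"
      by (rule moment[OF _ iso(3,4)]; measurable)+
    have "R (Suc k) \<le> (\<integral>\<omega>. (norm (A *v v k \<omega> - b))\<^sup>2 - (2 / c * ?p \<omega> - ?q \<omega> / c\<^sup>2) / L\<^sup>2 \<partial>M)"
      unfolding R_def
    proof (rule integral_mono)
      show "(norm (A *v v (Suc k) \<omega> - b))\<^sup>2
          \<le> (norm (A *v v k \<omega> - b))\<^sup>2 - (2 / c * ?p \<omega> - ?q \<omega> / c\<^sup>2) / L\<^sup>2" for \<omega>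
        unfolding v_Suc a_def L_def using c
        by (intro line_search_decrease \<open>A \<noteq> 0\<close>) simp_all
    qed (use int_r2 p(1) q(1) in \<open>auto simp del: inner_scaleR_right\<close>)
    also have "\<dots> = R k - (2 / c * (\<integral>\<omega>. ?p \<omega> \<partial>M) - (\<integral>\<omega>. ?q \<omega> \<partial>M) / c\<^sup>2) / L\<^sup>2"
      unfolding R_def using int_r2 p(1) q(1) by (simp del: inner_scaleR_right)
    also have "\<dots> = R k - G k / (c * L\<^sup>2)"
      unfolding p(2) q(2) using c L by (simp add: field_simps power2_eq_square)
    finally show ?thesis .
  qed
  have R0: "R 0 = (norm b)\<^sup>2" by (simp add: R_def v_def prob_space)
  have R_nonneg: "R k \<ge> 0" for k by (simp add: R_def)
  have telescope: "(\<Sum>k<n. G k) / (c * L\<^sup>2) \<le> R 0 - R n" for n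
  proof (induction n)
    case (Suc n)
    then show ?case using descent[of n] by (simp add: add_divide_distrib)
  qed simp
  have part1: "Min (G ` {0..N - 1}) \<le> c * L\<^sup>2 * (norm b)\<^sup>2 / real N" if "N \<ge> 1" for N
  proof -
    let ?m = "Min (G ` {0..N - 1})"
    have "real N * ?m = (\<Sum>k<N. ?m)" by simp
    also have "\<dots> \<le> (\<Sum>k<N. G k)"
      by (intro sum_mono Min_le) auto
    also have "\<dots> \<le> c * L\<^sup>2 * (norm b)\<^sup>2"
    proof -
      have "(\<Sum>k<N. G k) / (c * L\<^sup>2) \<le> (norm b)\<^sup>2"
        using telescope[of N] R_nonneg[of N] R0 by linarith
      moreover have "c * L\<^sup>2 > 0" using c L by simp
      ultimately show ?thesis by (simp add: pos_divide_le_eq mult.commute)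
    qed
    finally show ?thesis using that by (simp add: field_simps)
  qed
  have part2: "decseq (\<lambda>k. \<integral>\<omega>. norm (A *v v k \<omega> - b) \<partial>M)"
  proof (rule decseq_SucI, rule integral_mono[OF int_r int_r])
    show "norm (A *v v (Suc k) \<omega> - b) \<le> norm (A *v v k \<omega> - b)" for k \<omega>
      unfolding v_Suc by (rule norm_line_search_residual_le)
  qed
  define l where "l = lambda_min (A ** transpose A)"
  have part3: "R k \<le> (1 - l / (c * L\<^sup>2)) ^ k * (norm (A *v 0 - b))\<^sup>2" for k
  proof (induction k)
    case 0
    then show ?case by (simp add: R0)
  next
    case (Suc k)
    have "l * R k \<le> G k"
      unfolding R_def G_def a_def l_def
      using int_r2 int_a[unfolded a_def] lambda_min_gram_le
      by (subst integral_mult_right_zero[symmetric]) (intro integral_mono integrable_mult_right)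
    then have "R (Suc k) \<le> R k - l * R k / (c * L\<^sup>2)"
      using descent[of k] divide_right_mono[of "l * R k" "G k" "c * L\<^sup>2"] c by auto
    also have "\<dots> = (1 - l / (c * L\<^sup>2)) * R k" by (simp add: algebra_simps)
    also have "\<dots> \<le> (1 - l / (c * L\<^sup>2)) * ((1 - l / (c * L\<^sup>2)) ^ k * (norm (A *v 0 - b))\<^sup>2)"
    proof (intro mult_left_mono Suc.IH)
      have "l \<le> L\<^sup>2" unfolding l_def L_def by (rule lambda_min_gram_le_spectral_norm)
      also have "\<dots> \<le> c * L\<^sup>2" using c mult_right_mono[of 1 c "L\<^sup>2"] by simp
      finally show "0 \<le> 1 - l / (c * L\<^sup>2)" using c L by simp
    qed
    finally show ?case by (simp add: mult_ac)
  qed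
  show ?thesis
    using part1 part2 part3
    unfolding G_def[abs_def] R_def a_def L_def l_def by blast
qed

end
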